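(* Consider the canonical realisation with integer $a\ge3$ and $p\in(0,1)$, $q=1-p$ (see context), and suppose $(a,p)$ is such that the vertex condition (V) holds (in particular this is the case for $a=3$ and $a=4$ with any $p\in(0,1)$). Then for all $\gamma\in(0,1)$: $\partial_\gamma C(e_z,\gamma)>0$ for every site $z<a/2$; $\partial_\gamma C(e_z,\gamma)<0$ for every site $z>a/2$; and, if $a$ is even, $C(e_{a/2},\gamma)=C^\ast$, so $\partial_\gamma C(e_{a/2},\gamma)=0$. Every orbit $\{z,a-z\}$ ($z\ne a/2$) contributes exactly one site to each of the two sign classes. If $a$ is odd, no site $z$ has $C(e_z,\cdot)$ constant.
   Context: Canonical realisation (biased random walk with geometric resetting): let $a\ge3$ be an integer, $p\in(0,1)$, $q=1-p$, with sites $z\in\{1,\dots,a-1\}$ and modes $\nu\in\{1,\dots,a-1\}$. Put $\lambda_\nu=2\sqrt{pq}\cos(\pi\nu/a)$, $f_\nu(\gamma)=(1-\gamma)/(1-\lambda_\nu(1-\gamma))$ for $\gamma\in(0,1)$, $w_\nu=\frac{2\sqrt{pq}}a\sin\frac{\pi\nu}a$, $$A_\nu(z)=w_\nu\Big(\frac qp\Big)^{z/2}\sin\frac{\pi\nu z}a,\qquad B_\nu(z)=w_\nu\Big(\frac pq\Big)^{(a-z)/2}\sin\frac{\pi\nu(a-z)}a,$$ $u(z;\gamma)=\sum_\nu f_\nu(\gamma)A_\nu(z)$, $s(z;\gamma)=\sum_\nu f_\nu(\gamma)(A_\nu(z)+B_\nu(z))$. (Equivalently, $u(\cdot;\gamma)=t(I-tP)^{-1}b_0$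 and $s(\cdot;\gamma)=t(I-tP)^{-1}(b_0+b_a)$ with $t=1-\gamma$, where $P$ is the $(a-1)\times(a-1)$ matrix with $P_{z,z+1}=p$, $P_{z,z-1}=q$ and zero otherwise, $(b_0)_z=q\delta_{z,1}$, $(b_a)_z=p\delta_{z,a-1}$.) One has $s>0$, and at the vertex $e_z$ of the simplex of distributions on the sites, $C(e_z,\gamma)=u(z;\gamma)/s(z;\gamma)$. The involution is $\sigma(z)=a-z$, the weights $\kappa(z)=(p/q)^{a-z}$, $K=(p/q)^a$, $C^\ast=1/(1+\sqrt K)$. Orbits are the pairs $O=\{z,a-z\}$ with $z\ne a/2$; in each orbit a representative $z_O$ is fixed, and $\varphi_O(\gamma)=\sum_\nu f_\nu(\gamma)w^{(O)}_\nu$, where $w^{(O)}_\nu=\big[(1-C^\ast)A_\nu(z_O)-C^\ast\kappa(z_O)A_\nu(\sigma(z_O))\big]/\sqrt{\kappa(z_O)}$. With $\mathcal W[\varphi,s]=\varphi's-\varphi s'$ (derivatives in $\gamma$), the vertex condition (V) is: there is $\varepsilon\in\{\pm1\}$ such that for every orbit $O$ and both $z\in O$, $\varepsilon\,\mathcal W[\varphi_O,s(z;\cdot)](\gamma)>0$ for all $\gamma\in(0,1)$. *)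

theory Defs
  imports "HOL-Analysis.Analysis"
begin

text \<open>
  Biased random walk on \<open>{0, \<dots>, a}\<close> with absorbing ends, right/left step
  probabilities \<open>p\<close> and \<open>q = 1 - p\<close> (written out as \<open>1 - p\<close> below), and resetting
  parameter \<open>\<gamma>\<close>. The same index set \<open>{1, \<dots>, a - 1}\<close> serves for the sites and the modes.
\<close>

definition sites :: "nat \<Rightarrow> nat set" where
  "sites a = {1..a - 1}"

definition mode_lambda :: "nat \<Rightarrow> real \<Rightarrow> nat \<Rightarrow> real" where
  "mode_lambda a p \<nu> = 2 * sqrt (p * (1 - p)) * cos (pi * real \<nu> / real a)"

definition mode_f :: "nat \<Rightarrow> real \<Rightarrow> nat \<Rightarrow> real \<Rightarrow> real" where
  "mode_f a p \<nu> \<gamma> = (1 - \<gamma>) / (1 - mode_lambda a p \<nu> * (1 - \<gamma>))"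

definition mode_w :: "nat \<Rightarrow> real \<Rightarrow> nat \<Rightarrow> real" where
  "mode_w a p \<nu> = 2 * sqrt (p * (1 - p)) / real a * sin (pi * real \<nu> / real a)"

definition coeff_A :: "nat \<Rightarrow> real \<Rightarrow> nat \<Rightarrow> nat \<Rightarrow> real" where
  "coeff_A a p \<nu> z = mode_w a p \<nu> * ((1 - p) / p) powr (real z / 2)
     * sin (pi * real \<nu> * real z / real a)"

definition coeff_B :: "nat \<Rightarrow> real \<Rightarrow> nat \<Rightarrow> nat \<Rightarrow> real" where
  "coeff_B a p \<nu> z = mode_w a p \<nu> * (p / (1 - p)) powr ((real a - real z) / 2)
     * sin (pi * real \<nu> * (real a - real z) / real a)"

definition resp_u :: "nat \<Rightarrow> real \<Rightarrow> nat \<Rightarrow> real \<Rightarrow> real" where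
  "resp_u a p z \<gamma> = (\<Sum>\<nu>\<in>{1..a - 1}. mode_f a p \<nu> \<gamma> * coeff_A a p \<nu> z)"

definition resp_s :: "nat \<Rightarrow> real \<Rightarrow> nat \<Rightarrow> real \<Rightarrow> real" where
  "resp_s a p z \<gamma> = (\<Sum>\<nu>\<in>{1..a - 1}. mode_f a p \<nu> \<gamma> * (coeff_A a p \<nu> z + coeff_B a p \<nu> z))"

text \<open>The value \<open>C(e\<^sub>z, \<gamma>)\<close> at the vertex of the simplex that belongs to the site \<open>z\<close>.\<close>

definition C_vertex :: "nat \<Rightarrow> real \<Rightarrow> nat \<Rightarrow> real \<Rightarrow> real" where
  "C_vertex a p z \<gamma> = resp_u a p z \<gamma> / resp_s a p z \<gamma>"

definition reflect :: "nat \<Rightarrow> nat \<Rightarrow> nat" where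
  "reflect a z = a - z"

definition kappa :: "nat \<Rightarrow> real \<Rightarrow> nat \<Rightarrow> real" where
  "kappa a p z = (p / (1 - p)) ^ (a - z)"

definition K_const :: "nat \<Rightarrow> real \<Rightarrow> real" where
  "K_const a p = (p / (1 - p)) ^ a"

definition C_star :: "nat \<Rightarrow> real \<Rightarrow> real" where
  "C_star a p = 1 / (1 + sqrt (K_const a p))"

definition orbits :: "nat \<Rightarrow> nat set set" where
  "orbits a = {{z, reflect a z} | z. z \<in> sites a \<and> 2 * z \<noteq> a}"

definition orbit_reps :: "nat \<Rightarrow> (nat set \<Rightarrow> nat) \<Rightarrow> bool" where
  "orbit_reps a rep \<longleftrightarrow> (\<forall>orb\<in>orbits a. rep orb \<in> orb)"

definition orbit_w :: "nat \<Rightarrow> real \<Rightarrow> (nat set \<Rightarrow> nat) \<Rightarrow> nat set \<Rightarrow> nat \<Rightarrow> real" where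
  "orbit_w a p rep orb \<nu> =
     (let z = rep orb in
       ((1 - C_star a p) * coeff_A a p \<nu> z
          - C_star a p * kappa a p z * coeff_A a p \<nu> (reflect a z)) / sqrt (kappa a p z))"

definition orbit_phi :: "nat \<Rightarrow> real \<Rightarrow> (nat set \<Rightarrow> nat) \<Rightarrow> nat set \<Rightarrow> real \<Rightarrow> real" where
  "orbit_phi a p rep orb \<gamma> = (\<Sum>\<nu>\<in>{1..a - 1}. mode_f a p \<nu> \<gamma> * orbit_w a p rep orb \<nu>)"

definition wronskian :: "(real \<Rightarrow> real) \<Rightarrow> (real \<Rightarrow> real) \<Rightarrow> real \<Rightarrow> real" where
  "wronskian g h \<gamma> = deriv g \<gamma> * h \<gamma> - g \<gamma> * deriv h \<gamma>"

text \<open>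
  The vertex condition. Replacing the representative of an orbit by the other site flips the
  sign of \<open>orbit_phi\<close>, so the condition (one sign for all orbits) depends on \<open>rep\<close>.
\<close>

definition vertex_condition :: "nat \<Rightarrow> real \<Rightarrow> (nat set \<Rightarrow> nat) \<Rightarrow> bool" where
  "vertex_condition a p rep \<longleftrightarrow>
     (\<exists>\<epsilon>\<in>{1, - 1 :: real}. \<forall>orb\<in>orbits a. \<forall>z\<in>orb. \<forall>\<gamma>\<in>{0<..<1}.
        \<epsilon> * wronskian (orbit_phi a p rep orb) (resp_s a p z) \<gamma> > 0)"

text \<open>
  The two sign classes. Existence of the derivative is part of the condition, since
  \<open>deriv\<close> would have an unspecified value otherwise.
\<close>

definition pos_sites :: "nat \<Rightarrow> real \<Rightarrow> nat set" where
  "pos_sites a p = {z \<in> sites a. \<forall>\<gamma>\<in>{0<..<1}.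
     \<exists>D. (C_vertex a p z has_real_derivative D) (at \<gamma>) \<and> D > 0}"

definition neg_sites :: "nat \<Rightarrow> real \<Rightarrow> nat set" where
  "neg_sites a p = {z \<in> sites a. \<forall>\<gamma>\<in>{0<..<1}.
     \<exists>D. (C_vertex a p z has_real_derivative D) (at \<gamma>) \<and> D < 0}"

end

theory Submission
  imports Defs "HOL-Computational_Algebra.Polynomial"
begin

text \<open>
  Up to elementary factors, both \<open>u(z)\<close> and \<open>s(z)\<close> are combinations of the symmetrised sums
  \<open>G(z) = \<Sum>\<nu>. f\<^sub>\<nu> w\<^sub>\<nu> sin (\<pi> \<nu> z / a)\<close> at \<open>z\<close> and \<open>a - z\<close>. These sums solve the three-term
  recurrence \<open>G(z + 1) + G(z - 1) = x G(z)\<close> with \<open>x = 1 / ((1 - \<gamma>) sqrt (p q)) > 2\<close> and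
  boundary values \<open>1\<close> and \<open>0\<close>, hence \<open>G(z) = U\<^sub>a\<^sub>-\<^sub>z(x) / U\<^sub>a(x)\<close> with the
  Chebyshev polynomials \<open>U\<close>. The ratio \<open>U\<^sub>m / U\<^sub>k\<close> is strictly increasing on \<open>x \<ge> 2\<close> for
  \<open>k < m\<close>, by a Christoffel--Darboux argument for consecutive indices, which makes
  \<open>\<W>[G(z), G(a - z)]\<close> positive for \<open>z < a / 2\<close>. All Wronskians in question are
  positive multiples of this one, up to sign.
\<close>

section \<open>Chebyshev polynomials\<close>

text \<open>In the usual notation this is \<open>U\<^sub>k\<^sub>-\<^sub>1(x / 2)\<close>, i.e. \<open>sinh (k \<theta>) / sinh \<theta>\<close> at \<open>x = 2 cosh \<theta>\<close>.\<close>

fun cheb :: "nat \<Rightarrow> real poly" where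
  "cheb 0 = 0"
| "cheb (Suc 0) = 1"
| "cheb (Suc (Suc k)) = [:0, 1:] * cheb (Suc k) - cheb k"

text \<open>For x \<ge> 2 the recurrence gives \<open>cheb (k + 2)\<close> \<ge> 2
  \<open>cheb (k + 1)\<close> - \<open>cheb k\<close>, which exceeds \<open>cheb (k + 1)\<close>
  once \<open>cheb (k + 1)\<close> exceeds \<open>cheb k\<close>. Nonnegativity is carried along
  because it justifies multiplying by x.\<close>

lemma cheb_increasing:
  assumes "x \<ge> 2"
  shows "0 \<le> poly (cheb k) x \<and> poly (cheb k) x < poly (cheb (Suc k)) x"
proof (induction k)
  case (Suc k)
  have "2 * poly (cheb (Suc k)) x \<le> x * poly (cheb (Suc k)) x"
    using Suc assms by (intro mult_right_mono) auto
  moreover have "poly (cheb (Suc (Suc k))) x = x * poly (cheb (Suc k)) x - poly (cheb k) x"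
    by simp
  ultimately show ?case using Suc by (intro conjI) linarith+
qed simp

lemma cheb_pos: "x \<ge> 2 \<Longrightarrow> k > 0 \<Longrightarrow> poly (cheb k) x > 0"
  using cheb_increasing[of x "k - 1"] by auto

text \<open>The numerator of the derivative of the quotient \<open>cheb m / cheb k\<close>; its sign
  decides the monotonicity of that quotient.\<close>

definition cheb_wronskian :: "nat \<Rightarrow> nat \<Rightarrow> real \<Rightarrow> real" where
  "cheb_wronskian m k x =
     poly (pderiv (cheb m)) x * poly (cheb k) x - poly (cheb m) x * poly (pderiv (cheb k)) x"

text \<open>By the recurrence, raising both indices by one adds the square of
  \<open>cheb (Suc k)\<close>. The Wronskian of neighbours is thus a sum of squares for every real
  x: the confluent Christoffel--Darboux formula.\<close>

lemma cheb_wronskian_Suc_nonneg: "cheb_wronskian (Suc k) k x \<ge> 0"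
proof (induction k)
  case (Suc k)
  have "cheb_wronskian (Suc (Suc k)) (Suc k) x
      = (poly (cheb (Suc k)) x)\<^sup>2 + cheb_wronskian (Suc k) k x"
    by (simp add: cheb_wronskian_def pderiv_mult pderiv_diff pderiv_pCons algebra_simps power2_eq_square)
  then show ?case using Suc by simp
qed (simp add: cheb_wronskian_def)

text \<open>The last square in that sum is already strictly positive when x \<ge> 2.\<close>

lemma cheb_wronskian_Suc_pos:
  assumes "x \<ge> 2" "k > 0"
  shows "cheb_wronskian (Suc k) k x > 0"
proof -
  obtain j where k: "k = Suc j" using assms(2) gr0_implies_Suc by blast
  have "cheb_wronskian (Suc k) k x = (poly (cheb k) x)\<^sup>2 + cheb_wronskian k j x"
    by (simp add: k cheb_wronskian_def pderiv_mult pderiv_diff pderiv_pCons algebra_simps power2_eq_square)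
  then show ?thesis
    using cheb_pos[OF assms] cheb_wronskian_Suc_nonneg[of j x] k by (simp add: add_pos_nonneg)
qed

lemma cheb_wronskian_pos:
  assumes "x \<ge> 2" "k > 0" "k < m"
  shows "cheb_wronskian m k x > 0"
proof -
  have "Suc k \<le> m" using assms by simp
  then show ?thesis
  proof (induction m rule: dec_induct)
    case base
    show ?case using cheb_wronskian_Suc_pos assms by simp
  next
    case (step m)
    \<comment> \<open>The product rule for (\<open>cheb (Suc m)\<close> / \<open>cheb m\<close>) *
      (\<open>cheb m\<close> / \<open>cheb k\<close>), cleared of denominators: a product of
      positive increasing ratios is increasing.\<close>
    have "cheb_wronskian (Suc m) k x * poly (cheb m) x
        = cheb_wronskian (Suc m) m x * poly (cheb k) x
          + poly (cheb (Suc m)) x * cheb_wronskian m k x"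
      by (simp add: cheb_wronskian_def algebra_simps)
    also have "\<dots> > 0"
      using step cheb_wronskian_Suc_pos[OF assms(1), of m] cheb_pos[OF assms(1), of k]
        cheb_pos[OF assms(1), of "Suc m"] assms
      by (intro add_pos_pos mult_pos_pos) auto
    finally show ?case
      using cheb_pos[OF assms(1), of m] step by (simp add: zero_less_mult_iff)
  qed
qed

text \<open>A second-order recurrence with value 0 at index 0 leaves only the value at 1 free. The
  bound n is there because the sequence to be identified satisfies the recurrence only up to the
  boundary.\<close>

lemma cheb_recurrence_unique:
  fixes H :: "nat \<Rightarrow> real"
  assumes "\<And>k. k + 2 \<le> n \<Longrightarrow> H (k + 2) = x * H (k + 1) - H k" "H 0 = 0" "k \<le> n"
  shows "H k = H 1 * poly (cheb k) x"
  using assms(3)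
proof (induction k rule: cheb.induct)
  case (3 k)
  then show ?case using assms(1)[of k] by (simp add: algebra_simps)
qed (use assms in auto)

section \<open>Orthogonality of the modes\<close>

text \<open>The Dirichlet kernel: multiplying by 2 sin (x / 2) turns each cosine into a difference
  of sines at half-integer multiples of x, and the sum telescopes.\<close>

lemma sum_cos_multiples:
  "2 * sin (x / 2) * (\<Sum>\<nu>=1..n. cos (real \<nu> * x)) = sin (real n * x + x / 2) - sin (x / 2)"
proof (induction n)
  case (Suc n)
  have "sin (real (Suc n) * x + x / 2) - sin (real n * x + x / 2)
      = 2 * sin (x / 2) * cos (real (Suc n) * x)"
  proof -
    have e: "real n * x + x / 2 = real (Suc n) * x - x / 2" by (simp add: algebra_simps)
    show ?thesis unfolding e sin_add sin_diff by algebra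
  qed
  then show ?case using Suc by (simp add: algebra_simps)
qed simp

text \<open>At x = \<pi> k / a the upper end of the telescoped sum is sin (k \<pi> - x / 2), which
  is sin (x / 2) up to sign. The bounds on k put x / 2 strictly between 0 and \<pi>, so that sin (x
  / 2) can be cancelled.\<close>

lemma sum_cos_modes:
  assumes "0 < k" "k < 2 * a"
  shows "(\<Sum>\<nu>=1..a - 1. cos (real \<nu> * (pi * real k / real a))) = - (1 + (- 1) ^ k) / 2"
proof -
  define x where "x = pi * real k / real a"
  have a: "a > 0" using assms by simp
  have "0 < x / 2" "x / 2 < pi" using assms by (auto simp: x_def field_simps)
  then have s: "sin (x / 2) > 0" by (rule sin_gt_zero)
  have e: "real (a - 1) * x + x / 2 = real k * pi - x / 2"
    using a by (simp add: x_def field_simps)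
  have "sin (real k * pi - x / 2) = - ((- 1) ^ k) * sin (x / 2)"
    by (simp add: sin_diff)
  then have "2 * sin (x / 2) * (\<Sum>\<nu>=1..a - 1. cos (real \<nu> * x))
      = - (1 + (- 1) ^ k) * sin (x / 2)"
    unfolding sum_cos_multiples e by (simp add: algebra_simps)
  then have "2 * (\<Sum>\<nu>=1..a - 1. cos (real \<nu> * x)) = - (1 + (- 1) ^ k)"
    using s by (simp add: mult.assoc mult.left_commute)
  then show ?thesis unfolding x_def[symmetric] by (simp add: eq_divide_eq mult.commute)
qed

text \<open>Discrete sine orthogonality. Product-to-sum leaves cosine sums at the indices z - 1 and
  z + 1, which have equal parity and so cancel, except at z = 1, where the index 0 turns every
  cosine into 1.\<close>

lemma sum_sin_modes:
  assumes "0 < z" "z < a"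
  shows "(\<Sum>\<nu>=1..a - 1. sin (pi * real \<nu> / real a) * sin (pi * real \<nu> * real z / real a))
    = (if z = 1 then real a / 2 else 0)"
proof -
  define c where "c k = (\<Sum>\<nu>=1..a - 1. cos (real \<nu> * (pi * real k / real a)))" for k
  have "(\<Sum>\<nu>=1..a - 1. sin (pi * real \<nu> / real a) * sin (pi * real \<nu> * real z / real a))
      = (\<Sum>\<nu>=1..a - 1. (cos (real \<nu> * (pi * real (z - 1) / real a))
          - cos (real \<nu> * (pi * real (z + 1) / real a))) / 2)"
  proof (rule sum.cong[OF refl])
    fix \<nu> :: nat
    define t where "t = pi * real \<nu> / real a"
    define y where "y = pi * real \<nu> * real z / real a"
    have "real \<nu> * (pi * real (z - 1) / real a) = y - t"
         "real \<nu> * (pi * real (z + 1) / real a) = y + t"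
      using assms by (auto simp: t_def y_def field_simps)
    then show "sin (pi * real \<nu> / real a) * sin (pi * real \<nu> * real z / real a)
       = (cos (real \<nu> * (pi * real (z - 1) / real a))
          - cos (real \<nu> * (pi * real (z + 1) / real a))) / 2"
      unfolding t_def[symmetric] y_def[symmetric] by (simp add: cos_add cos_diff)
  qed
  also have "\<dots> = (c (z - 1) - c (z + 1)) / 2"
    by (simp add: c_def sum_subtractf flip: sum_divide_distrib)
  also have "c (z + 1) = - (1 + (- 1) ^ (z + 1)) / 2"
    unfolding c_def by (rule sum_cos_modes) (use assms in auto)
  also have "c (z - 1) = (if z = 1 then real a - 1 else - (1 + (- 1) ^ (z - 1)) / 2)"
  proof (cases "z = 1")
    case True
    then show ?thesis using assms by (simp add: c_def of_nat_diff)
  next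
    case False
    then show ?thesis using sum_cos_modes[of "z - 1" a] assms by (simp add: c_def)
  qed
  also have "(- 1 :: real) ^ (z + 1) = (- 1) ^ (z - 1)"
    using assms(1) by (cases z) auto
  finally show ?thesis by (simp split: if_splits)
qed

section \<open>The symmetrised mode sums\<close>

definition mode_sum :: "nat \<Rightarrow> real \<Rightarrow> nat \<Rightarrow> real \<Rightarrow> real" where
  "mode_sum a p z \<gamma> =
     (\<Sum>\<nu>\<in>{1..a - 1}. mode_f a p \<nu> \<gamma> * (mode_w a p \<nu> * sin (pi * real \<nu> * real z / real a)))"

text \<open>The spectral parameter: with t = 1 - \<gamma>, the symmetrised I - t P has off-diagonal
  entries - t sqrt (p q), and dividing by t sqrt (p q) leaves this value on the diagonal.\<close>

definition resolvent_arg :: "real \<Rightarrow> real \<Rightarrow> real" where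
  "resolvent_arg p \<gamma> = 1 / ((1 - \<gamma>) * sqrt (p * (1 - p)))"

lemma two_sqrt_le_one:
  fixes p :: real
  assumes "0 < p" "p < 1"
  shows "2 * sqrt (p * (1 - p)) \<le> 1"
  using arith_geo_mean_sqrt[of p "1 - p"] assms by simp

lemma resolvent_arg_ge_2:
  assumes "0 < p" "p < 1" "0 < \<gamma>" "\<gamma> < 1"
  shows "resolvent_arg p \<gamma> \<ge> 2"
proof -
  have r: "0 < sqrt (p * (1 - p))" "2 * sqrt (p * (1 - p)) \<le> 1"
    using assms two_sqrt_le_one by auto
  have "(1 - \<gamma>) * (2 * sqrt (p * (1 - p))) \<le> 1 * 1"
    using assms r by (intro mult_mono) auto
  then show ?thesis using assms r by (simp add: resolvent_arg_def field_simps)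
qed

lemma mode_f_denominator_pos:
  assumes "0 < p" "p < 1" "0 < \<gamma>" "\<gamma> < 1"
  shows "1 - mode_lambda a p \<nu> * (1 - \<gamma>) > 0"
proof -
  have "\<bar>mode_lambda a p \<nu>\<bar> \<le> 1 * 1"
    unfolding mode_lambda_def abs_mult[of "2 * sqrt (p * (1 - p))"]
    using two_sqrt_le_one[OF assms(1,2)] assms by (intro mult_mono) auto
  then have "mode_lambda a p \<nu> * (1 - \<gamma>) \<le> 1 * (1 - \<gamma>)"
    using assms by (intro mult_right_mono) auto
  also have "\<dots> < 1" using assms by simp
  finally show ?thesis by simp
qed

text \<open>Each mode is an eigenvector of the neighbour sum, and \<open>mode_f\<close> satisfies f
  = t + t \<lambda> f. The term t \<lambda> f yields the two neighbours; the term t leaves a source,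
  which by orthogonality is concentrated at site 1.\<close>

lemma mode_sum_recurrence:
  assumes "0 < p" "p < 1" "0 < \<gamma>" "\<gamma> < 1" "0 < z" "z < a"
  shows "resolvent_arg p \<gamma> * mode_sum a p z \<gamma> =
    (if z = 1 then 1 else mode_sum a p (z - 1) \<gamma>) + mode_sum a p (z + 1) \<gamma>"
proof -
  define t where "t = 1 - \<gamma>"
  define r where "r = sqrt (p * (1 - p))"
  define S where "S \<nu> y = sin (pi * real \<nu> * real y / real a)" for \<nu> y
  have t: "t > 0" and r: "r > 0" using assms by (auto simp: t_def r_def)
  have f: "mode_f a p \<nu> \<gamma> * S \<nu> z
      = t * S \<nu> z + t * r * (mode_f a p \<nu> \<gamma> * S \<nu> (z - 1) + mode_f a p \<nu> \<gamma> * S \<nu> (z + 1))" for \<nu>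
  proof -
    have d: "1 - mode_lambda a p \<nu> * t > 0"
      using mode_f_denominator_pos[OF assms(1-4)] by (simp add: t_def)
    have f: "mode_f a p \<nu> \<gamma> = t + t * mode_lambda a p \<nu> * mode_f a p \<nu> \<gamma>"
      unfolding mode_f_def t_def[symmetric] using d by (simp add: field_simps)
    have l: "mode_lambda a p \<nu> * S \<nu> z = r * (S \<nu> (z - 1) + S \<nu> (z + 1))"
    proof -
      define \<theta> where "\<theta> = pi * real \<nu> / real a"
      define y where "y = pi * real \<nu> * real z / real a"
      have e: "pi * real \<nu> * real (z - 1) / real a = y - \<theta>"
           "pi * real \<nu> * real (z + 1) / real a = y + \<theta>"
        using assms by (auto simp: \<theta>_def y_def field_simps)
      show ?thesis
        unfolding mode_lambda_def S_def r_def[symmetric] e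
        unfolding \<theta>_def[symmetric] y_def[symmetric]
        by (simp add: sin_add sin_diff algebra_simps)
    qed
    have "mode_f a p \<nu> \<gamma> * S \<nu> z = (t + t * mode_lambda a p \<nu> * mode_f a p \<nu> \<gamma>) * S \<nu> z"
      by (rule arg_cong[OF f, of "\<lambda>y. y * S \<nu> z"])
    also have "\<dots> = t * S \<nu> z + t * mode_f a p \<nu> \<gamma> * (mode_lambda a p \<nu> * S \<nu> z)"
      by (simp add: algebra_simps)
    finally show ?thesis unfolding l by (simp add: algebra_simps)
  qed
  have w: "(\<Sum>\<nu>=1..a - 1. mode_w a p \<nu> * S \<nu> z) = (if z = 1 then r else 0)"
  proof -
    have "(\<Sum>\<nu>=1..a - 1. mode_w a p \<nu> * S \<nu> z)
        = 2 * r / real a * (\<Sum>\<nu>=1..a - 1. sin (pi * real \<nu> / real a) * S \<nu> z)"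
      by (simp add: mode_w_def r_def sum_distrib_left mult.assoc)
    then show ?thesis using sum_sin_modes[OF assms(5,6)] assms by (simp add: S_def)
  qed
  have "mode_sum a p z \<gamma> = (\<Sum>\<nu>=1..a - 1. mode_w a p \<nu> * (mode_f a p \<nu> \<gamma> * S \<nu> z))"
    by (simp add: mode_sum_def S_def mult_ac)
  also have "\<dots> = t * (\<Sum>\<nu>=1..a - 1. mode_w a p \<nu> * S \<nu> z)
      + t * r * (mode_sum a p (z - 1) \<gamma> + mode_sum a p (z + 1) \<gamma>)"
    unfolding f mode_sum_def S_def[symmetric]
    by (simp add: sum_distrib_left algebra_simps sum.distrib)
  \<comment> \<open>All sines vanish at site 0, so for z = 1 the left neighbour contributes nothing
    and its place is taken by the source, which is worth exactly 1 after t r is factored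
    out.\<close>
  also have "mode_sum a p (z - 1) \<gamma> = (if z = 1 then 0 else mode_sum a p (z - 1) \<gamma>)"
    by (simp add: mode_sum_def)
  finally have "mode_sum a p z \<gamma> = t * r *
      ((if z = 1 then 1 else mode_sum a p (z - 1) \<gamma>) + mode_sum a p (z + 1) \<gamma>)"
    unfolding w by (simp add: algebra_simps)
  then show ?thesis
    using t r unfolding resolvent_arg_def t_def[symmetric] r_def[symmetric] by simp
qed

text \<open>Counted from the end a, where every mode vanishes, the sums form a solution of the
  recurrence starting at 0, hence a multiple of the Chebyshev sequence. The boundary value 1 at the
  other end fixes the multiple.\<close>

lemma mode_sum_eq_cheb:
  assumes "0 < p" "p < 1" "0 < \<gamma>" "\<gamma> < 1" "0 < z" "z < a"
  shows "mode_sum a p z \<gamma> =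
    poly (cheb (a - z)) (resolvent_arg p \<gamma>) / poly (cheb a) (resolvent_arg p \<gamma>)"
proof -
  define x where "x = resolvent_arg p \<gamma>"
  \<comment> \<open>The sum vanishes at \<open>z = 0\<close>; the inhomogeneity of the recurrence acts as the boundary value 1.\<close>
  define H where "H k = (if k = a then 1 else mode_sum a p (a - k) \<gamma>)" for k
  have "sin (pi * real \<nu>) = 0" for \<nu> :: nat
    using sin_npi2 by simp
  then have H0: "H 0 = 0" using assms by (simp add: H_def mode_sum_def)
  have rec: "H (k + 2) = x * H (k + 1) - H k" if "k + 2 \<le> a" for k
  proof -
    \<comment> \<open>The recurrence is applied at site a - (k + 1). This is site 1 exactly when k +
      2 = a, and there \<open>H (k + 2)\<close> is the boundary value 1.\<close>
    have e: "a - (k + 1) - 1 = a - (k + 2)" "a - (k + 1) + 1 = a - k" "a - (k + 1) = 1 \<longleftrightarrow> k + 2 = a"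
      using that by auto
    show ?thesis
      using mode_sum_recurrence[OF assms(1-4), of "a - (k + 1)" a] that
      unfolding e by (auto simp: H_def x_def)
  qed
  have H: "H k = H 1 * poly (cheb k) x" if "k \<le> a" for k
    using cheb_recurrence_unique[of a H x k] rec H0 that by blast
  have "poly (cheb a) x > 0"
    using resolvent_arg_ge_2[OF assms(1-4)] assms by (intro cheb_pos) (auto simp: x_def)
  moreover have "1 = H 1 * poly (cheb a) x" using H[of a] by (simp add: H_def)
  moreover have "mode_sum a p z \<gamma> = H (a - z)" using assms by (simp add: H_def)
  ultimately show ?thesis using H[of "a - z"] by (simp add: x_def field_simps)
qed

lemma mode_sum_pos:
  assumes "0 < p" "p < 1" "0 < \<gamma>" "\<gamma> < 1" "0 < z" "z < a"
  shows "mode_sum a p z \<gamma> > 0"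
  unfolding mode_sum_eq_cheb[OF assms] using assms resolvent_arg_ge_2[OF assms(1-4)]
  by (intro divide_pos_pos cheb_pos) auto

section \<open>Wronskian of the mode sums in \<gamma>\<close>

lemma resolvent_arg_has_derivative:
  assumes "0 < p" "p < 1" "0 < \<gamma>" "\<gamma> < 1"
  shows "\<exists>D>0. (resolvent_arg p has_real_derivative D) (at \<gamma>)"
proof (intro exI conjI)
  define r where "r = sqrt (p * (1 - p))"
  have r: "r > 0" using assms by (simp add: r_def)
  show "r / ((1 - \<gamma>) * r)\<^sup>2 > 0" using r assms by simp
  have "((\<lambda>\<gamma>. 1 / ((1 - \<gamma>) * r)) has_real_derivative r / ((1 - \<gamma>) * r)\<^sup>2) (at \<gamma>)"
    using r assms by (auto intro!: derivative_eq_intros simp: power2_eq_square)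
  then show "(resolvent_arg p has_real_derivative r / ((1 - \<gamma>) * r)\<^sup>2) (at \<gamma>)"
    by (simp add: resolvent_arg_def[abs_def] r_def)
qed

text \<open>The closed forms are established for \<gamma> in (0, 1) only. As this interval is open,
  agreement on it transfers derivatives at each of its points.\<close>

lemma has_real_derivative_unit_interval_cong:
  fixes f g :: "real \<Rightarrow> real"
  assumes "(g has_real_derivative D) (at \<gamma>)" "\<gamma> \<in> {0<..<1}"
    "\<And>x. x \<in> {0<..<1} \<Longrightarrow> f x = g x"
  shows "(f has_real_derivative D) (at \<gamma>)"
  by (rule has_field_derivative_transform_within_open[OF assms(1), of "{0<..<1}"])
     (use assms in auto)

text \<open>Both sums share the denominator \<open>cheb a\<close>, which enters their Wronskian only
  as a squared divisor. What remains is \<open>cheb_wronskian (a - z) z\<close>, positive since z <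
  a - z, times the positive derivative of \<open>resolvent_arg\<close>.\<close>

lemma mode_sum_wronskian_pos:
  assumes "0 < p" "p < 1" "0 < \<gamma>" "\<gamma> < 1" "0 < z" "2 * z < a"
  obtains D D' where
    "(mode_sum a p z has_real_derivative D) (at \<gamma>)"
    "(mode_sum a p (a - z) has_real_derivative D') (at \<gamma>)"
    "D * mode_sum a p (a - z) \<gamma> - mode_sum a p z \<gamma> * D' > 0"
proof -
  obtain d where d: "d > 0" "(resolvent_arg p has_real_derivative d) (at \<gamma>)"
    using resolvent_arg_has_derivative[OF assms(1-4)] by blast
  define x where "x = resolvent_arg p \<gamma>"
  have x: "x \<ge> 2" using resolvent_arg_ge_2[OF assms(1-4)] by (simp add: x_def)
  have a: "poly (cheb a) x > 0" using x assms by (intro cheb_pos) auto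
  \<comment> \<open>The derivative in \<gamma> of \<open>cheb k / cheb a\<close> along
    \<open>resolvent_arg\<close>, by the quotient and chain rules.\<close>
  define Q where "Q k = (poly (pderiv (cheb k)) x * poly (cheb a) x
      - poly (cheb k) x * poly (pderiv (cheb a)) x) / (poly (cheb a) x)\<^sup>2 * d" for k
  have deriv: "(mode_sum a p y has_real_derivative Q (a - y)) (at \<gamma>)" if "0 < y" "y < a" for y
  proof (rule has_real_derivative_unit_interval_cong)
    have "((\<lambda>x. poly (cheb (a - y)) x / poly (cheb a) x) has_real_derivative
        (poly (pderiv (cheb (a - y))) x * poly (cheb a) x
          - poly (cheb (a - y)) x * poly (pderiv (cheb a)) x)
        / (poly (cheb a) x * poly (cheb a) x)) (at x)"
      using a by (intro DERIV_divide poly_DERIV) auto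
    from DERIV_chain2[OF this[unfolded x_def] d(2)]
    show "((\<lambda>\<gamma>. poly (cheb (a - y)) (resolvent_arg p \<gamma>) / poly (cheb a) (resolvent_arg p \<gamma>))
        has_real_derivative Q (a - y)) (at \<gamma>)"
      by (simp add: Q_def x_def power2_eq_square)
  qed (use assms that mode_sum_eq_cheb in auto)
  have G: "mode_sum a p z \<gamma> = poly (cheb (a - z)) x / poly (cheb a) x"
    "mode_sum a p (a - z) \<gamma> = poly (cheb z) x / poly (cheb a) x"
    using mode_sum_eq_cheb[OF assms(1-4), of z a] mode_sum_eq_cheb[OF assms(1-4), of "a - z" a] assms
    by (auto simp: x_def)
  have "Q (a - z) * mode_sum a p (a - z) \<gamma> - mode_sum a p z \<gamma> * Q z
      = d * cheb_wronskian (a - z) z x / (poly (cheb a) x)\<^sup>2"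
    unfolding G Q_def cheb_wronskian_def using a by (simp add: field_simps power2_eq_square)
  also have "\<dots> > 0"
    using d a cheb_wronskian_pos[OF x, of z "a - z"] assms by auto
  finally show thesis
    using that deriv[of z] deriv[of "a - z"] assms by simp
qed

section \<open>Responses in terms of the mode sums\<close>

text \<open>The diagonal of the similarity transformation that makes the transition matrix
  symmetric, with off-diagonal entries sqrt (p q).\<close>

definition bias :: "real \<Rightarrow> nat \<Rightarrow> real" where
  "bias p z = ((1 - p) / p) powr (real z / 2)"

lemma bias_pos: "0 < p \<Longrightarrow> p < 1 \<Longrightarrow> bias p z > 0"
  by (simp add: bias_def)

lemma sqrt_K_const_pos: "0 < p \<Longrightarrow> p < 1 \<Longrightarrow> sqrt (K_const a p) > 0"
  by (simp add: K_const_def)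

lemma sqrt_odds_power:
  assumes "0 < p" "p < 1"
  shows "sqrt ((p / (1 - p)) ^ n) = (p / (1 - p)) powr (real n / 2)"
proof -
  have "sqrt ((p / (1 - p)) ^ n) = ((p / (1 - p)) powr real n) powr (1 / 2)"
    using assms by (simp add: powr_half_sqrt powr_realpow)
  then show ?thesis by (simp add: powr_powr)
qed

lemma bias_eq_odds_powr:
  assumes "0 < p" "p < 1"
  shows "bias p z = (p / (1 - p)) powr (- real z / 2)"
proof -
  have "bias p z = inverse (p / (1 - p)) powr (real z / 2)"
    by (simp add: bias_def)
  also have "\<dots> = inverse ((p / (1 - p)) powr (real z / 2))"
    by (rule inverse_powr)
  finally show ?thesis by (simp add: powr_minus)
qed

text \<open>Gives \<open>coeff_B\<close> the same site factor as \<open>coeff_A\<close>; the rest is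
  a constant independent of z.\<close>

lemma odds_powr_eq:
  assumes "0 < p" "p < 1"
  shows "(p / (1 - p)) powr ((real a - real z) / 2) = bias p z * sqrt (K_const a p)"
  unfolding bias_eq_odds_powr[OF assms] K_const_def sqrt_odds_power[OF assms] powr_add[symmetric]
  by (simp add: field_simps)

lemma coeff_A_eq:
  "coeff_A a p \<nu> z = bias p z * (mode_w a p \<nu> * sin (pi * real \<nu> * real z / real a))"
  by (simp add: coeff_A_def bias_def)

lemma coeff_B_eq:
  assumes "0 < p" "p < 1" "z \<le> a"
  shows "coeff_B a p \<nu> z = bias p z * sqrt (K_const a p) *
    (mode_w a p \<nu> * sin (pi * real \<nu> * real (a - z) / real a))"
  using assms by (simp add: coeff_B_def odds_powr_eq of_nat_diff)

lemma resp_u_eq: "resp_u a p z \<gamma> = bias p z * mode_sum a p z \<gamma>"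
  by (simp add: resp_u_def mode_sum_def coeff_A_eq sum_distrib_left mult_ac)

lemma resp_s_eq:
  assumes "0 < p" "p < 1" "z \<le> a"
  shows "resp_s a p z \<gamma> =
    bias p z * (mode_sum a p z \<gamma> + sqrt (K_const a p) * mode_sum a p (a - z) \<gamma>)"
  using assms
  by (simp add: resp_s_def mode_sum_def coeff_A_eq coeff_B_eq sum_distrib_left sum.distrib algebra_simps)

text \<open>With k = sqrt K, three identities make the prefactors collapse to \<open>C_star\<close>:
  sqrt \<kappa>(z) = \<open>bias p z\<close> k, \<kappa>(z) \<open>bias p (a - z)\<close> =
  \<open>bias p z\<close> k, and 1 - \<open>C_star\<close> = \<open>C_star\<close> k. The result is
  antisymmetric under reflection.\<close>

lemma orbit_w_eq:
  assumes "0 < p" "p < 1" "rep orb \<le> a"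
  shows "orbit_w a p rep orb \<nu> = C_star a p *
    (mode_w a p \<nu> * sin (pi * real \<nu> * real (rep orb) / real a)
     - mode_w a p \<nu> * sin (pi * real \<nu> * real (a - rep orb) / real a))"
proof -
  define z where "z = rep orb"
  define k where "k = sqrt (K_const a p)"
  have z: "z \<le> a" using assms by (simp add: z_def)
  have k: "k > 0" using sqrt_K_const_pos[OF assms(1,2)] by (simp add: k_def)
  have kap: "sqrt (kappa a p z) = bias p z * k"
    using odds_powr_eq[OF assms(1,2), of a z] sqrt_odds_power[OF assms(1,2)] z
    by (simp add: kappa_def k_def of_nat_diff)
  have "kappa a p z = sqrt (kappa a p z) * sqrt (kappa a p z)"
    using assms by (simp add: kappa_def)
  moreover have "sqrt (kappa a p z) * bias p (a - z) = 1"
    using sqrt_odds_power[OF assms(1,2), of "a - z"] assms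
    by (simp add: kappa_def bias_eq_odds_powr flip: powr_add)
  ultimately have kap': "kappa a p z * bias p (a - z) = bias p z * k"
    using kap by (metis mult.assoc mult.right_neutral)
  have C: "1 - C_star a p = C_star a p * k"
    using k by (simp add: C_star_def k_def[symmetric] field_simps)
  have b: "bias p z > 0" using bias_pos assms by blast
  show ?thesis
    unfolding orbit_w_def Let_def reflect_def z_def[symmetric] coeff_A_eq kap C
    using kap' k b by (simp add: field_simps)
qed

lemma orbit_phi_eq:
  assumes "0 < p" "p < 1" "rep orb \<le> a"
  shows "orbit_phi a p rep orb \<gamma> =
    C_star a p * (mode_sum a p (rep orb) \<gamma> - mode_sum a p (a - rep orb) \<gamma>)"
  using assms
  by (simp add: orbit_phi_def mode_sum_def orbit_w_eq sum_distrib_left sum_subtractf algebra_simps)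

section \<open>Derivatives of the vertex values\<close>

lemma C_vertex_eq:
  assumes "0 < p" "p < 1" "z \<le> a"
  shows "C_vertex a p z \<gamma> =
    mode_sum a p z \<gamma> / (mode_sum a p z \<gamma> + sqrt (K_const a p) * mode_sum a p (a - z) \<gamma>)"
  using assms bias_pos[OF assms(1,2), of z] by (simp add: C_vertex_def resp_u_eq resp_s_eq)

lemma C_vertex_has_derivative:
  assumes "0 < p" "p < 1" "z \<in> sites a" "\<gamma> \<in> {0<..<1}"
    and "(mode_sum a p z has_real_derivative D) (at \<gamma>)"
    and "(mode_sum a p (a - z) has_real_derivative D') (at \<gamma>)"
  shows "\<exists>c>0. (C_vertex a p z has_real_derivative
    c * (D * mode_sum a p (a - z) \<gamma> - mode_sum a p z \<gamma> * D')) (at \<gamma>)"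
proof (intro exI conjI)
  define k where "k = sqrt (K_const a p)"
  define G where "G = mode_sum a p z"
  define G' where "G' = mode_sum a p (a - z)"
  have k: "k > 0" using sqrt_K_const_pos[OF assms(1,2)] by (simp add: k_def)
  have "G \<gamma> > 0" "G' \<gamma> > 0"
    unfolding G_def G'_def using assms by (auto intro!: mode_sum_pos simp: sites_def)
  then have pos: "G \<gamma> + k * G' \<gamma> > 0" using k by (simp add: add_pos_pos)
  show "k / (G \<gamma> + k * G' \<gamma>)\<^sup>2 > 0" using k pos by simp
  have d: "(G has_real_derivative D) (at \<gamma>)" "(G' has_real_derivative D') (at \<gamma>)"
    using assms by (auto simp: G_def G'_def)
  have "((\<lambda>\<gamma>. G \<gamma> / (G \<gamma> + k * G' \<gamma>)) has_real_derivative
      (D * (G \<gamma> + k * G' \<gamma>) - G \<gamma> * (D + k * D'))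
        / ((G \<gamma> + k * G' \<gamma>) * (G \<gamma> + k * G' \<gamma>))) (at \<gamma>)"
    using pos by (intro DERIV_divide DERIV_add DERIV_cmult d) auto
  moreover have "C_vertex a p z = (\<lambda>\<gamma>. G \<gamma> / (G \<gamma> + k * G' \<gamma>))"
    using assms by (auto simp: C_vertex_eq G_def G'_def k_def sites_def)
  moreover have "(D * (G \<gamma> + k * G' \<gamma>) - G \<gamma> * (D + k * D'))
      / ((G \<gamma> + k * G' \<gamma>) * (G \<gamma> + k * G' \<gamma>))
    = k / (G \<gamma> + k * G' \<gamma>)\<^sup>2 * (D * G' \<gamma> - G \<gamma> * D')"
    by (simp add: power2_eq_square algebra_simps)
  ultimately show "(C_vertex a p z has_real_derivative
      k / (G \<gamma> + k * G' \<gamma>)\<^sup>2 * (D * mode_sum a p (a - z) \<gamma> - mode_sum a p z \<gamma> * D')) (at \<gamma>)"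
    by (simp add: G_def G'_def)
qed

lemma C_vertex_deriv_pos:
  assumes "0 < p" "p < 1" "z \<in> sites a" "2 * z < a" "\<gamma> \<in> {0<..<1}"
  shows "\<exists>D. (C_vertex a p z has_real_derivative D) (at \<gamma>) \<and> D > 0"
proof -
  obtain D D' where
    "(mode_sum a p z has_real_derivative D) (at \<gamma>)"
    "(mode_sum a p (a - z) has_real_derivative D') (at \<gamma>)"
    and W: "D * mode_sum a p (a - z) \<gamma> - mode_sum a p z \<gamma> * D' > 0"
    using mode_sum_wronskian_pos[of p \<gamma> z a] assms by (auto simp: sites_def)
  then show ?thesis
    using C_vertex_has_derivative[of p z a \<gamma> D D'] assms mult_pos_pos by blast
qed

text \<open>The mirror site a - z lies in the lower half, and exchanging the two arguments negates
  the Wronskian.\<close>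

lemma C_vertex_deriv_neg:
  assumes "0 < p" "p < 1" "z \<in> sites a" "2 * z > a" "\<gamma> \<in> {0<..<1}"
  shows "\<exists>D. (C_vertex a p z has_real_derivative D) (at \<gamma>) \<and> D < 0"
proof -
  have z: "a - (a - z) = z" "z < a" "2 * (a - z) < a" using assms by (auto simp: sites_def)
  obtain D D' where d:
    "(mode_sum a p (a - z) has_real_derivative D) (at \<gamma>)"
    "(mode_sum a p z has_real_derivative D') (at \<gamma>)"
    and W: "D * mode_sum a p z \<gamma> - mode_sum a p (a - z) \<gamma> * D' > 0"
    using mode_sum_wronskian_pos[of p \<gamma> "a - z" a] assms z by auto
  have "D' * mode_sum a p (a - z) \<gamma> - mode_sum a p z \<gamma> * D < 0"
    using W by (simp add: mult.commute)
  then show ?thesis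
    using C_vertex_has_derivative[of p z a \<gamma> D' D] d assms mult_pos_neg by blast
qed

text \<open>The midpoint is its own reflection, so both mode sums coincide and cancel.\<close>

lemma C_vertex_middle:
  assumes "0 < p" "p < 1" "a > 0" "even a" "\<gamma> \<in> {0<..<1}"
  shows "C_vertex a p (a div 2) \<gamma> = C_star a p"
proof -
  obtain m where m: "a = 2 * m" using assms(4) by blast
  have G: "mode_sum a p m \<gamma> > 0" using assms m by (intro mode_sum_pos) auto
  have "C_vertex a p m \<gamma>
      = mode_sum a p m \<gamma> / (mode_sum a p m \<gamma> * (1 + sqrt (K_const a p)))"
    using assms m by (simp add: C_vertex_eq algebra_simps)
  also have "\<dots> = C_star a p" using G by (simp add: C_star_def)
  finally have "C_vertex a p m \<gamma> = C_star a p" .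
  then show ?thesis using m by simp
qed

section \<open>The vertex condition for a single orbit\<close>

text \<open>By bilinearity and antisymmetry, W[G - G', G + k G'] = (1 + k) W[G, G'], and
  \<open>C_star\<close> (1 + k) = 1. The sign records whether z or its mirror image represents the
  orbit.\<close>

lemma wronskian_orbit_phi_resp_s:
  assumes "0 < p" "p < 1" "z \<in> sites a" "rep orb \<in> {z, a - z}"
    and "(mode_sum a p z has_real_derivative D) (at \<gamma>)"
    and "(mode_sum a p (a - z) has_real_derivative D') (at \<gamma>)"
  shows "wronskian (orbit_phi a p rep orb) (resp_s a p z) \<gamma> =
    (if rep orb = z then 1 else - 1) * bias p z *
    (D * mode_sum a p (a - z) \<gamma> - mode_sum a p z \<gamma> * D')"
proof -
  define k where "k = sqrt (K_const a p)"
  define G where "G = mode_sum a p z"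
  define G' where "G' = mode_sum a p (a - z)"
  define e :: real where "e = (if rep orb = z then 1 else - 1)"
  have z: "0 < z" "z < a" "a - (a - z) = z" using assms by (auto simp: sites_def)
  have d: "(G has_real_derivative D) (at \<gamma>)" "(G' has_real_derivative D') (at \<gamma>)"
    using assms by (auto simp: G_def G'_def)
  have phi: "orbit_phi a p rep orb = (\<lambda>\<gamma>. e * C_star a p * (G \<gamma> - G' \<gamma>))"
    by (rule ext) (use assms z in \<open>auto simp: orbit_phi_eq G_def G'_def e_def algebra_simps\<close>)
  have s: "resp_s a p z = (\<lambda>\<gamma>. bias p z * (G \<gamma> + k * G' \<gamma>))"
    by (rule ext) (use assms z in \<open>auto simp: resp_s_eq G_def G'_def k_def\<close>)
  have dphi: "deriv (orbit_phi a p rep orb) \<gamma> = e * C_star a p * (D - D')"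
    unfolding phi by (intro DERIV_imp_deriv DERIV_cmult DERIV_diff d)
  have ds: "deriv (resp_s a p z) \<gamma> = bias p z * (D + k * D')"
    unfolding s by (intro DERIV_imp_deriv DERIV_cmult DERIV_add d)
  have C: "C_star a p * (1 + k) = 1"
    using sqrt_K_const_pos[OF assms(1,2), of a]
    unfolding C_star_def k_def[symmetric] by simp
  have "wronskian (orbit_phi a p rep orb) (resp_s a p z) \<gamma>
      = e * bias p z * (C_star a p * (1 + k)) * (D * G' \<gamma> - G \<gamma> * D')"
    unfolding wronskian_def dphi ds unfolding phi s by (simp add: algebra_simps)
  then show ?thesis unfolding C by (simp add: e_def G_def G'_def)
qed

text \<open>Passing from z to a - z flips both the representative sign and the Wronskian of the mode
  sums, so the overall sign depends only on the half containing the representative.\<close>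

lemma wronskian_orbit_pos:
  assumes "0 < p" "p < 1" "z \<in> sites a" "2 * z \<noteq> a" "rep orb \<in> {z, a - z}" "\<gamma> \<in> {0<..<1}"
  shows "(if 2 * rep orb < a then 1 else - 1) * wronskian (orbit_phi a p rep orb) (resp_s a p z) \<gamma> > 0"
proof (cases "2 * z < a")
  case True
  obtain D D' where
    "(mode_sum a p z has_real_derivative D) (at \<gamma>)"
    "(mode_sum a p (a - z) has_real_derivative D') (at \<gamma>)"
    and W: "D * mode_sum a p (a - z) \<gamma> - mode_sum a p z \<gamma> * D' > 0"
    using mode_sum_wronskian_pos[of p \<gamma> z a] assms True by (auto simp: sites_def)
  then show ?thesis
    using wronskian_orbit_phi_resp_s[of p z a rep orb D \<gamma> D'] assms True bias_pos[of p z] W by auto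
next
  case False
  then have z: "a - (a - z) = z" "z < a" "2 * (a - z) < a" "a - z \<noteq> z"
    using assms by (auto simp: sites_def)
  obtain D D' where d:
    "(mode_sum a p (a - z) has_real_derivative D) (at \<gamma>)"
    "(mode_sum a p z has_real_derivative D') (at \<gamma>)"
    and W: "D * mode_sum a p z \<gamma> - mode_sum a p (a - z) \<gamma> * D' > 0"
    using mode_sum_wronskian_pos[of p \<gamma> "a - z" a] assms z by auto
  have "D' * mode_sum a p (a - z) \<gamma> - mode_sum a p z \<gamma> * D < 0"
    using W by (simp add: mult.commute)
  then show ?thesis
    using wronskian_orbit_phi_resp_s[of p z a rep orb D' \<gamma> D] d assms False z bias_pos[of p z]
    by (auto simp: mult_pos_neg)
qed

text \<open>For these two sizes {1, a - 1} is the only orbit, so \<epsilon> can be read off from the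
  position of its representative.\<close>

lemma vertex_condition_small:
  assumes "0 < p" "p < 1" "a = 3 \<or> a = 4" "orbit_reps a rep"
  shows "vertex_condition a p rep"
proof -
  have orb: "orb = {1, a - 1}" if "orb \<in> orbits a" for orb
    using that assms(3) by (auto simp: orbits_def sites_def reflect_def)
  have "{1, a - 1} \<in> orbits a"
    using assms(3) by (auto simp: orbits_def sites_def reflect_def)
  then have rep: "rep {1, a - 1} \<in> {1, a - 1}" using assms(4) by (auto simp: orbit_reps_def)
  show ?thesis unfolding vertex_condition_def
  proof (intro bexI ballI)
    fix orb z \<gamma> assume "orb \<in> orbits a" and z: "z \<in> orb" and \<gamma>: "\<gamma> \<in> {0<..<1::real}"
    then have o: "orb = {1, a - 1}" using orb by blast
    have ne: "2 * z \<noteq> a" using z o assms(3) by (cases "z = 1") auto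
    show "(if 2 * rep {1, a - 1} < a then 1 else - 1)
        * wronskian (orbit_phi a p rep orb) (resp_s a p z) \<gamma> > 0"
      unfolding o by (rule wronskian_orbit_pos) (use assms z \<gamma> rep o ne in \<open>auto simp: sites_def\<close>)
  qed simp
qed

section \<open>Sign classes and non-constancy\<close>

lemma pos_sites_iff:
  assumes "0 < p" "p < 1" "z \<in> sites a" "2 * z \<noteq> a"
  shows "z \<in> pos_sites a p \<longleftrightarrow> 2 * z < a"
proof
  \<comment> \<open>One sample point, here 1 / 2, suffices: a site in the upper half would have a
    negative derivative there, against uniqueness of the derivative.\<close>
  assume "z \<in> pos_sites a p"
  then obtain D where D: "(C_vertex a p z has_real_derivative D) (at (1 / 2))" "D > 0"
    by (fastforce simp: pos_sites_def)
  show "2 * z < a"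
  proof (rule ccontr)
    assume "\<not> 2 * z < a"
    then obtain D' where "(C_vertex a p z has_real_derivative D') (at (1 / 2))" "D' < 0"
      using C_vertex_deriv_neg[of p z a "1 / 2"] assms by auto
    then show False using D DERIV_unique by fastforce
  qed
qed (use assms C_vertex_deriv_pos in \<open>auto simp: pos_sites_def\<close>)

lemma neg_sites_iff:
  assumes "0 < p" "p < 1" "z \<in> sites a" "2 * z \<noteq> a"
  shows "z \<in> neg_sites a p \<longleftrightarrow> 2 * z > a"
proof
  assume "z \<in> neg_sites a p"
  then obtain D where D: "(C_vertex a p z has_real_derivative D) (at (1 / 2))" "D < 0"
    by (fastforce simp: neg_sites_def)
  show "2 * z > a"
  proof (rule ccontr)
    assume "\<not> 2 * z > a"
    then obtain D' where "(C_vertex a p z has_real_derivative D') (at (1 / 2))" "D' > 0"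
      using C_vertex_deriv_pos[of p z a "1 / 2"] assms by auto
    then show False using D DERIV_unique by fastforce
  qed
qed (use assms C_vertex_deriv_neg in \<open>auto simp: neg_sites_def\<close>)

lemma C_vertex_not_constant:
  assumes "0 < p" "p < 1" "z \<in> sites a" "2 * z \<noteq> a"
  shows "\<not> C_vertex a p z constant_on {0<..<1}"
proof
  assume "C_vertex a p z constant_on {0<..<1}"
  then obtain c where c: "\<And>\<gamma>. \<gamma> \<in> {0<..<1} \<Longrightarrow> C_vertex a p z \<gamma> = c"
    by (auto simp: constant_on_def)
  have "(C_vertex a p z has_real_derivative 0) (at (1 / 2))"
    by (rule has_real_derivative_unit_interval_cong[of "\<lambda>_. c"]) (use c in auto)
  moreover have "\<exists>D. (C_vertex a p z has_real_derivative D) (at (1 / 2)) \<and> D \<noteq> 0"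
    using C_vertex_deriv_pos[of p z a "1 / 2"] C_vertex_deriv_neg[of p z a "1 / 2"] assms
    by (cases "2 * z < a") fastforce+
  ultimately show False using DERIV_unique by blast
qed

theorem corollary6p11:
  fixes a :: nat and p :: real and rep :: "nat set \<Rightarrow> nat"
  assumes "a \<ge> 3" and "0 < p" and "p < 1" and "orbit_reps a rep"
  shows "(a = 3 \<or> a = 4 \<longrightarrow> vertex_condition a p rep) \<and>
    (vertex_condition a p rep \<longrightarrow>
      (\<forall>\<gamma>\<in>{0<..<1}.
         (\<forall>z\<in>sites a. 2 * z < a \<longrightarrow>
            (\<exists>D. (C_vertex a p z has_real_derivative D) (at \<gamma>) \<and> D > 0)) \<and>
         (\<forall>z\<in>sites a. 2 * z > a \<longrightarrow>
            (\<exists>D. (C_vertex a p z has_real_derivative D) (at \<gamma>) \<and> D < 0)) \<and>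
         (even a \<longrightarrow>
            C_vertex a p (a div 2) \<gamma> = C_star a p \<and>
            (C_vertex a p (a div 2) has_real_derivative 0) (at \<gamma>))) \<and>
      (\<forall>orb\<in>orbits a.
         (\<exists>!z. z \<in> orb \<and> z \<in> pos_sites a p) \<and>
         (\<exists>!z. z \<in> orb \<and> z \<in> neg_sites a p)) \<and>
      (odd a \<longrightarrow> (\<forall>z\<in>sites a. \<not> C_vertex a p z constant_on {0<..<1})))"
proof -
  note p = assms(2,3)
  have middle: "C_vertex a p (a div 2) \<gamma> = C_star a p" if "even a" "\<gamma> \<in> {0<..<1}" for \<gamma>
    by (rule C_vertex_middle[OF p _ that]) (use assms(1) in simp)
  have middle_deriv: "(C_vertex a p (a div 2) has_real_derivative 0) (at \<gamma>)"
    if "even a" "\<gamma> \<in> {0<..<1}" for \<gamma>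
    by (rule has_real_derivative_unit_interval_cong[OF DERIV_const that(2) middle[OF that(1)]])
  have orbit: "(\<exists>!z. z \<in> orb \<and> z \<in> pos_sites a p) \<and> (\<exists>!z. z \<in> orb \<and> z \<in> neg_sites a p)"
    if orb: "orb \<in> orbits a" for orb
  proof -
    obtain z where o: "orb = {z, a - z}" and z: "z \<in> sites a" "2 * z \<noteq> a"
      using orb by (auto simp: orbits_def reflect_def)
    \<comment> \<open>Reflection exchanges the two halves, so each orbit has one site in
      each.\<close>
    have z': "a - z \<in> sites a" "2 * (a - z) \<noteq> a" "2 * (a - z) < a \<longleftrightarrow> a < 2 * z"
      "a < 2 * (a - z) \<longleftrightarrow> 2 * z < a"
      using z by (auto simp: sites_def)
    note iffs = pos_sites_iff[OF p z] pos_sites_iff[OF p z'(1,2)]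
      neg_sites_iff[OF p z] neg_sites_iff[OF p z'(1,2)]
    consider "2 * z < a" "\<not> a < 2 * z" | "a < 2 * z" "\<not> 2 * z < a"
      using z(2) by linarith
    then show ?thesis
    proof cases
      case 1
      then have "z \<in> pos_sites a p" "a - z \<notin> pos_sites a p"
        "z \<notin> neg_sites a p" "a - z \<in> neg_sites a p"
        unfolding iffs z'(3,4) by simp_all
      then show ?thesis unfolding o by blast
    next
      case 2
      then have "z \<notin> pos_sites a p" "a - z \<in> pos_sites a p"
        "z \<in> neg_sites a p" "a - z \<notin> neg_sites a p"
        unfolding iffs z'(3,4) by simp_all
      then show ?thesis unfolding o by blast
    qed
  qed
  \<comment> \<open>For odd a, parity excludes a site fixed by the reflection.\<close>
  have nonconst: "\<not> C_vertex a p z constant_on {0<..<1}" if "odd a" "z \<in> sites a" for z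
    by (rule C_vertex_not_constant[OF p that(2)]) (use that(1) in auto)
  show ?thesis
    using vertex_condition_small[OF p _ assms(4)] C_vertex_deriv_pos[OF p] C_vertex_deriv_neg[OF p]
      middle middle_deriv orbit nonconst
    by (intro conjI impI ballI) simp_all
qed

end
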